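(* Let $m\geqslant 3$ and $n\geqslant 3$ be distinct odd integers. Then the number of distinct $C_4$-face-magic projective labelings on $\mathcal{P}_{m,n}$ with $C_4$-face-magic value $2mn+1$, counted up to symmetries of the projective plane, is at least $\bigl(\tau(m,n)+\tau(n,m)\bigr)\,2^{m/2+n/2-3}\,\beta(m)\,\beta(n)$; the same lower bound holds for the number of those with $C_4$-face-magic value $2mn+3$.
   Context: $\mathcal{P}_{m,n}$ has vertices $(i,j)$, $1\leqslant i\leqslant m$, $1\leqslant j\leqslant n$, and edges $(i,j)$–$(i,j+1)$ ($j\leqslant n-1$), $(i,n)$–$(m+1-i,1)$, $(i,j)$–$(i+1,j)$ ($i\leqslant m-1$), $(m,j)$–$(1,n+1-j)$, embedded naturally in the projective plane. Its 4-cycle faces are $\{(i,j),(i+1,j),(i,j+1),(i+1,j+1)\}$ ($1\leqslant i\leqslant m-1$, $1\leqslant j\leqslant n-1$), $\{(i,n),(i+1,n),(m+1-i,1),(m-i,1)\}$ ($1\leqslant i\leqslant m-1$), $\{(m,j),(m,j+1),(1,n+1-j),(1,n-j)\}$ ($1\leqslant j\leqslant n-1$); the other two faces are digons. A $C_4$-face-magic projective labeling is a bijection from the vertices onto $\{1,\ldots,mn\}$ such that every 4-cycle face has the same label sum, the $C_4$-face-magic value. For $m\neq n$ the symmetries of $\mathcal{P}_{m,n}$ are the four automorphisms $(i,j)\mapsto(i,j)$, $(i,j)\mapsto(m+1-i,n+1-j)$, $(i,j)\mapsto(i,n+1-j)$, $(i,j)\mapsto(m+1-i,j)$; labelings are counted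 up to precomposition with these. For positive integer $k$, an $(m,n)$-projective factorization sequence is a tuple $(m_1,n_1,\ldots,m_k,n_k)$ of integers $>1$ with $m=m_1\cdots m_k$, $n=n_1\cdots n_k$, or a tuple $(m_1,n_1,\ldots,m_k,n_k,m_{k+1})$ of integers $>1$ with $m=m_1\cdots m_{k+1}$, $n=n_1\cdots n_k$; $\tau(m,n)$ is the number of distinct $(m,n)$-projective factorization sequences (of all lengths), and $\tau(n,m)$ is defined with the roles of $m$ and $n$ exchanged. For odd $m\geqslant3$, $\beta(m)=\bigl((\tfrac{m-1}{4})!\bigr)^2$ if $m\equiv1\pmod4$ and $\beta(m)=(\tfrac{m-3}{4})!\,(\tfrac{m+1}{4})!$ if $m\equiv3\pmod4$. *)

theory Defs
  imports Main "HOL-Library.FuncSet"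
begin

definition proj_vertices :: "nat \<Rightarrow> nat \<Rightarrow> (nat \<times> nat) set" where
  "proj_vertices m n = {1..m} \<times> {1..n}"

(* The embedding of the projective grid graph enters only through its 4-cycle faces:
   the interior squares, followed by the squares crossing the two twisted seams
   (i,n) -- (m+1-i,1) and (m,j) -- (1,n+1-j).  The two digon faces are not listed.
   All subtractions are exact in the stated index ranges. *)
definition proj_C4_faces :: "nat \<Rightarrow> nat \<Rightarrow> (nat \<times> nat) set set" where
  "proj_C4_faces m n =
     {{(i, j), (i + 1, j), (i, j + 1), (i + 1, j + 1)} | i j.
        i \<in> {1..m - 1} \<and> j \<in> {1..n - 1}} \<union>
     {{(i, n), (i + 1, n), (m + 1 - i, 1), (m - i, 1)} | i. i \<in> {1..m - 1}} \<union>
     {{(m, j), (m, j + 1), (1, n + 1 - j), (1, n - j)} | j. j \<in> {1..n - 1}}"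

(* Labelings are taken to be extensional (undefined outside the vertex set), so that
   two of them are equal iff they agree on all vertices. *)
definition C4_face_magic_labelings :: "nat \<Rightarrow> nat \<Rightarrow> nat \<Rightarrow> (nat \<times> nat \<Rightarrow> nat) set" where
  "C4_face_magic_labelings m n S =
     {f \<in> extensional (proj_vertices m n).
        bij_betw f (proj_vertices m n) {1..m * n} \<and>
        (\<forall>F \<in> proj_C4_faces m n. (\<Sum>v\<in>F. f v) = S)}"

(* The symmetries for m \<noteq> n; the square case has further ones. *)
definition proj_symmetries :: "nat \<Rightarrow> nat \<Rightarrow> (nat \<times> nat \<Rightarrow> nat \<times> nat) set" where
  "proj_symmetries m n =
     {\<lambda>(i, j). (i, j),
      \<lambda>(i, j). (m + 1 - i, n + 1 - j),
      \<lambda>(i, j). (i, n + 1 - j),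
      \<lambda>(i, j). (m + 1 - i, j)}"

definition labeling_equiv ::
  "nat \<Rightarrow> nat \<Rightarrow> nat \<Rightarrow> ((nat \<times> nat \<Rightarrow> nat) \<times> (nat \<times> nat \<Rightarrow> nat)) set" where
  "labeling_equiv m n S =
     {(f, g). f \<in> C4_face_magic_labelings m n S \<and> g \<in> C4_face_magic_labelings m n S \<and>
        (\<exists>\<sigma> \<in> proj_symmetries m n. \<forall>v \<in> proj_vertices m n. g v = f (\<sigma> v))}"

definition num_C4_face_magic_labelings :: "nat \<Rightarrow> nat \<Rightarrow> nat \<Rightarrow> nat" where
  "num_C4_face_magic_labelings m n S =
     card (C4_face_magic_labelings m n S // labeling_equiv m n S)"

(* The tuple (m_1, n_1, m_2, n_2, ...) is a list indexed from 0: m_(i+1) is entry 2 * i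
   and n_(i+1) is entry 2 * i + 1. *)
definition proj_factorization_seqs :: "nat \<Rightarrow> nat \<Rightarrow> nat list set" where
  "proj_factorization_seqs m n =
     {xs. (\<forall>x \<in> set xs. x > 1) \<and>
        (\<exists>k \<ge> 1.
           (length xs = 2 * k \<and>
              m = (\<Prod>i<k. xs ! (2 * i)) \<and> n = (\<Prod>i<k. xs ! (2 * i + 1))) \<or>
           (length xs = 2 * k + 1 \<and>
              m = (\<Prod>i<k + 1. xs ! (2 * i)) \<and> n = (\<Prod>i<k. xs ! (2 * i + 1))))}"

definition tau :: "nat \<Rightarrow> nat \<Rightarrow> nat" where
  "tau m n = card (proj_factorization_seqs m n)"

(* Only meaningful for odd m \<ge> 3, where the divisions are exact. *)
definition beta :: "nat \<Rightarrow> nat" where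
  "beta m =
     (if m mod 4 = 1 then (fact ((m - 1) div 4))\<^sup>2
      else fact ((m - 3) div 4) * fact ((m + 1) div 4))"

end

theory Submission
  imports Defs "HOL-Library.Set_Algebras"
begin

text \<open>
  Write \<open>H = (mn - 1) / 2\<close> and index rows and columns by their offsets \<open>u, v\<close> from the centre.
  Suppose \<open>A\<close> and \<open>B\<close> are symmetric sets of integers of sizes \<open>m\<close> and \<open>n\<close> such that every integer
  in \<open>[-H, H]\<close> is uniquely \<open>a + b\<close> with \<open>a\<close> in \<open>A\<close> and \<open>b\<close> in \<open>B\<close>, and let \<open>P\<close> and \<open>Q\<close> be
  odd, parity-preserving bijections from the offsets onto \<open>A\<close> and \<open>B\<close>. Then
  \<open>c = H + P u + Q v\<close> runs through \<open>0, \<dots>, mn - 1\<close> with parities alternating like a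
  chessboard, and sending even \<open>c\<close> to \<open>c / 2 + 1\<close> and odd \<open>c\<close> to \<open>mn - (c - 1) / 2\<close> gives a labeling
  of value \<open>2mn + 3\<close>: on each face the two even and the two odd values of \<open>c\<close> have the same
  sum (across the seams because \<open>P\<close> and \<open>Q\<close> are odd). Complementing the labels gives \<open>2mn + 1\<close>.

  Mixed-radix expansions turn every factorization sequence into such a pair \<open>(A, B)\<close>. Its first
  entry \<open>f\<close> can be recovered from \<open>A\<close>, whose longest initial segment \<open>{0, \<dots>, k}\<close> has
  \<open>k = (f - 1) / 2\<close>; the remaining entries follow recursively. For given \<open>(A, B)\<close> there are
  at least \<open>2 ^ ((m - 1) / 2) \<beta>(m)\<close> choices of \<open>P\<close> and \<open>2 ^ ((n - 1) / 2) \<beta>(n)\<close> choices of \<open>Q\<close>,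
  all giving different labelings, and each class modulo the symmetries contains at most four
  labelings.
\<close>

subsection \<open>Direct sumsets\<close>

definition direct_sumset :: "'a::plus set \<Rightarrow> 'a set \<Rightarrow> bool" where
  "direct_sumset A B \<longleftrightarrow> inj_on (\<lambda>(a, b). a + b) (A \<times> B)"

lemma direct_sumsetI:
  assumes "\<And>a a' b b'. a \<in> A \<Longrightarrow> a' \<in> A \<Longrightarrow> b \<in> B \<Longrightarrow> b' \<in> B \<Longrightarrow> a + b = a' + b' \<Longrightarrow>
    a = a' \<and> b = b'"
  shows "direct_sumset A B"
  using assms by (auto simp: direct_sumset_def inj_on_def)

lemma direct_sumsetD:
  assumes "direct_sumset A B" "a + b = a' + b'" "a \<in> A" "a' \<in> A" "b \<in> B" "b' \<in> B"
  shows "a = a'" and "b = b'"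
  using assms by (auto simp: direct_sumset_def inj_on_def)

lemma bij_betw_direct_sumset:
  "direct_sumset A B \<Longrightarrow> bij_betw (\<lambda>(a, b). a + b) (A \<times> B) (A + B)"
  by (simp add: direct_sumset_def bij_betw_def set_plus_image)

lemma card_direct_sumset: "direct_sumset A B \<Longrightarrow> card (A + B) = card A * card B"
  using bij_betw_same_card[OF bij_betw_direct_sumset] by (fastforce simp: card_cartesian_product)

lemma direct_sumset_commute:
  fixes A B :: "'a::ab_semigroup_add set"
  assumes "direct_sumset A B"
  shows "direct_sumset B A"
  using direct_sumsetD[OF assms] by (intro direct_sumsetI) (metis add.commute)

lemma direct_sumset_assoc:
  fixes A B C :: "'a::semigroup_add set"
  assumes "direct_sumset B C" and "direct_sumset A (B + C)"
  shows "direct_sumset (A + B) C"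
proof (rule direct_sumsetI)
  fix x x' c c'
  assume "x \<in> A + B" "x' \<in> A + B" and c: "c \<in> C" "c' \<in> C" and eq: "x + c = x' + c'"
  then obtain a b a' b' where x: "x = a + b" "x' = a' + b'"
    and ab: "a \<in> A" "b \<in> B" "a' \<in> A" "b' \<in> B"
    by (auto simp: set_plus_def)
  have "a + (b + c) = a' + (b' + c')"
    using eq x by (simp add: add.assoc)
  with ab c have "a = a'" "b + c = b' + c'"
    using direct_sumsetD[OF assms(2)] by blast+
  with ab c x show "x = x' \<and> c = c'"
    using direct_sumsetD[OF assms(1)] by blast
qed

lemma elt_set_times_eq_image: "c *o A = (*) c ` A"
  by (auto simp: elt_set_times_def)

lemma elt_set_times_cancel_left:
  fixes c :: "'a::ring_no_zero_divisors"
  assumes "c \<noteq> 0"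
  shows "c *o A = c *o B \<longleftrightarrow> A = B"
  using assms by (simp add: elt_set_times_eq_image inj_image_eq_iff inj_def)

lemma card_elt_set_times:
  fixes c :: "'a::ring_no_zero_divisors"
  assumes "c \<noteq> 0"
  shows "card (c *o A) = card A"
  using assms by (simp add: elt_set_times_eq_image card_image inj_on_def)

lemma direct_sumset_elt_set_times:
  fixes c :: "'a::ring_no_zero_divisors"
  assumes "c \<noteq> 0" and "direct_sumset A B"
  shows "direct_sumset (c *o A) (c *o B)"
proof (rule direct_sumsetI)
  fix x x' y y'
  assume "x \<in> c *o A" "x' \<in> c *o A" "y \<in> c *o B" "y' \<in> c *o B" and eq: "x + y = x' + y'"
  then obtain a a' b b' where "x = c * a" "x' = c * a'" "y = c * b" "y' = c * b'"
    and ab: "a \<in> A" "a' \<in> A" "b \<in> B" "b' \<in> B"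
    by (auto simp: elt_set_times_def)
  moreover from this eq have "a + b = a' + b'"
    using assms(1) by (simp flip: distrib_left)
  ultimately show "x = x' \<and> y = y'"
    using direct_sumsetD[OF assms(2)] by blast
qed

subsection \<open>Symmetric sets\<close>

definition symmetric_set :: "'a::uminus set \<Rightarrow> bool" where
  "symmetric_set A \<longleftrightarrow> (\<forall>a\<in>A. - a \<in> A)"

lemma symmetric_set_plus:
  fixes A B :: "'a::ab_group_add set"
  assumes "symmetric_set A" "symmetric_set B"
  shows "symmetric_set (A + B)"
  using assms by (force simp: symmetric_set_def set_plus_def)

lemma symmetric_set_elt_set_times:
  fixes c :: "'a::ring"
  assumes "symmetric_set A"
  shows "symmetric_set (c *o A)"
  using assms by (force simp: symmetric_set_def elt_set_times_def)

lemma card_symmetric_set: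
  fixes A :: "'a::linordered_ab_group_add set"
  assumes "finite A" "symmetric_set A"
  shows "card A = of_bool (0 \<in> A) + 2 * card (A \<inter> {0<..})"
proof -
  let ?P = "A \<inter> {0<..}"
  have "x \<in> ?P \<union> uminus ` ?P \<union> A \<inter> {0}" if "x \<in> A" for x
    using that assms(2) by (cases x "0::'a" rule: linorder_cases)
      (auto simp: symmetric_set_def intro: image_eqI[of _ _ "- x"])
  then have "A = ?P \<union> uminus ` ?P \<union> A \<inter> {0}"
    using assms(2) by (auto simp: symmetric_set_def)
  also have "card \<dots> = card (?P \<union> uminus ` ?P) + card (A \<inter> {0})"
    using assms(1) by (intro card_Un_disjoint) auto
  also have "card (?P \<union> uminus ` ?P) = card ?P + card (uminus ` ?P)"
    using assms(1) by (intro card_Un_disjoint) auto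
  finally show ?thesis
    by (simp add: card_image)
qed

lemma zero_mem_symmetric_set:
  fixes A :: "'a::linordered_ab_group_add set"
  assumes "symmetric_set A" "odd (card A)"
  shows "0 \<in> A"
proof -
  have "finite A"
    using assms(2) by (rule contrapos_pp) simp
  with assms show ?thesis
    by (auto simp: card_symmetric_set split: if_splits)
qed

subsection \<open>Mixed-radix expansions of centered intervals\<close>

definition centered_interval :: "nat \<Rightarrow> int set" where
  "centered_interval n = {- int (n div 2)..int (n div 2)}"

lemma mem_centered_interval_iff: "k \<in> centered_interval n \<longleftrightarrow> \<bar>k\<bar> \<le> int (n div 2)"
  by (auto simp: centered_interval_def)

lemma zero_mem_centered_interval [simp]: "0 \<in> centered_interval n"
  by (simp add: centered_interval_def)

lemma finite_centered_interval [simp]: "finite (centered_interval n)"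
  by (simp add: centered_interval_def)

lemma card_centered_interval: "card (centered_interval n) = 2 * (n div 2) + 1"
  by (simp add: centered_interval_def)

lemma symmetric_centered_interval: "symmetric_set (centered_interval n)"
  by (simp add: symmetric_set_def mem_centered_interval_iff)

lemma mixed_radix_eq_iff:
  fixes k k' a a' :: int
  assumes "odd f" "k \<in> centered_interval f" "k' \<in> centered_interval f"
  shows "k + int f * a = k' + int f * a' \<longleftrightarrow> k = k' \<and> a = a'"
proof
  assume "k + int f * a = k' + int f * a'"
  then have eq: "k - k' = int f * (a' - a)"
    by (simp add: algebra_simps)
  have "\<bar>k - k'\<bar> < int f"
    using assms by (auto simp: mem_centered_interval_iff elim!: oddE)
  with eq have "k - k' = 0"
    by (metis dvd_imp_le_int dvd_triv_left abs_of_nat not_le)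
  with eq assms(1) show "k = k' \<and> a = a'"
    by auto
qed simp

lemma direct_sumset_mixed_radix:
  "odd f \<Longrightarrow> direct_sumset (centered_interval f) (int f *o X)"
  by (rule direct_sumsetI) (auto simp: elt_set_times_def mixed_radix_eq_iff)

lemma centered_interval_mixed_radix:
  assumes "odd f" "odd g"
  shows "centered_interval f + int f *o centered_interval g = centered_interval (f * g)"
proof (rule card_subset_eq)
  have half: "int (f * g div 2) = int (f div 2) + int f * int (g div 2)"
    using assms by (auto elim!: oddE simp: algebra_simps)
  show "centered_interval f + int f *o centered_interval g \<subseteq> centered_interval (f * g)"
  proof
    fix x assume "x \<in> centered_interval f + int f *o centered_interval g"
    then obtain k a where x: "x = k + int f * a" and "\<bar>k\<bar> \<le> int (f div 2)" "\<bar>a\<bar> \<le> int (g div 2)"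
      by (auto simp: set_plus_def elt_set_times_def mem_centered_interval_iff)
    moreover from this have "int f * \<bar>a\<bar> \<le> int f * int (g div 2)"
      by (intro mult_left_mono) auto
    moreover have "\<bar>x\<bar> \<le> \<bar>k\<bar> + int f * \<bar>a\<bar>"
      unfolding x by (metis abs_triangle_ineq abs_mult abs_of_nat)
    ultimately show "x \<in> centered_interval (f * g)"
      unfolding mem_centered_interval_iff half by linarith
  qed
  show "card (centered_interval f + int f *o centered_interval g)
      = card (centered_interval (f * g))"
    using assms by (simp add: card_direct_sumset direct_sumset_mixed_radix card_elt_set_times
        card_centered_interval odd_two_times_div_two_succ odd_pos)
qed simp

lemma mixed_radix_mem_iff:
  assumes "odd f" "k \<in> centered_interval f"
  shows "k + int f * a \<in> centered_interval f + int f *o X \<longleftrightarrow> a \<in> X"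
  using mixed_radix_eq_iff[OF assms] assms(2)
  by (auto simp: set_plus_def elt_set_times_def)

lemma mixed_radix_cancel:
  assumes "odd f" "centered_interval f + int f *o X = centered_interval f + int f *o Y"
  shows "X = Y"
  using mixed_radix_mem_iff[OF assms(1) zero_mem_centered_interval] assms(2) by blast

subsection \<open>Symmetric tilings\<close>

definition symmetric_tilings :: "nat \<Rightarrow> nat \<Rightarrow> (int set \<times> int set) set" where
  "symmetric_tilings m n =
     {(A, B). symmetric_set A \<and> symmetric_set B \<and> card A = m \<and> card B = n \<and>
        direct_sumset A B \<and> A + B = centered_interval (m * n)}"

lemma symmetric_tilings_swap:
  "(A, B) \<in> symmetric_tilings m n \<Longrightarrow> (B, A) \<in> symmetric_tilings n m"
  by (auto simp: symmetric_tilings_def add.commute mult.commute intro: direct_sumset_commute)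

lemma odd_mult_symmetric_tiling:
  assumes "(A, B) \<in> symmetric_tilings m n"
  shows "odd (m * n)"
proof -
  have "m * n = card (centered_interval (m * n))"
    using assms by (auto simp: symmetric_tilings_def simp flip: card_direct_sumset)
  then show ?thesis
    by (metis card_centered_interval dvd_triv_left even_plus_one_iff)
qed

lemma symmetric_tilings_extend:
  assumes "(A, B) \<in> symmetric_tilings m n" "odd f"
  shows "(centered_interval f + int f *o B, int f *o A) \<in> symmetric_tilings (f * n) m"
proof -
  have tiling: "symmetric_set A" "symmetric_set B" "card A = m" "card B = n"
    "direct_sumset B A" "B + A = centered_interval (n * m)"
    using symmetric_tilings_swap[OF assms(1)] by (auto simp: symmetric_tilings_def)
  have f: "int f \<noteq> 0"
    using assms(2) by (auto dest: odd_pos)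
  have sum: "int f *o B + int f *o A = int f *o centered_interval (n * m)"
    using tiling by (simp flip: set_times_plus_distrib2)
  have "card (centered_interval f + int f *o B) = f * n"
    using assms(2) f tiling by (simp add: card_direct_sumset direct_sumset_mixed_radix
        card_elt_set_times card_centered_interval)
  moreover have "direct_sumset (centered_interval f + int f *o B) (int f *o A)"
    using assms(2) f tiling(5)
    by (intro direct_sumset_assoc direct_sumset_elt_set_times)
      (auto simp: sum direct_sumset_mixed_radix)
  moreover have "centered_interval f + int f *o B + int f *o A = centered_interval (f * n * m)"
    using centered_interval_mixed_radix[of f "n * m"] odd_mult_symmetric_tiling[OF assms(1)]
      assms(2)
    by (simp add: sum add.assoc mult_ac)
  ultimately show ?thesis
    using tiling f by (simp add: symmetric_tilings_def card_elt_set_times symmetric_set_plus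
        symmetric_set_elt_set_times symmetric_centered_interval)
qed

lemma zero_mem_symmetric_tiling:
  assumes "(A, B) \<in> symmetric_tilings m n"
  shows "0 \<in> A"
  using assms odd_mult_symmetric_tiling[OF assms]
  by (auto simp: symmetric_tilings_def intro: zero_mem_symmetric_set)

lemma symmetric_tiling_subset:
  assumes "(A, B) \<in> symmetric_tilings m n"
  shows "A \<subseteq> centered_interval (m * n)"
proof -
  have "0 \<in> B"
    using symmetric_tilings_swap[OF assms] by (rule zero_mem_symmetric_tiling)
  then show ?thesis
    using assms set_zero_plus2[of B A] by (simp add: symmetric_tilings_def add.commute)
qed

lemma finite_symmetric_tiling: "(A, B) \<in> symmetric_tilings m n \<Longrightarrow> finite A"
  by (rule finite_subset[OF symmetric_tiling_subset]) simp_all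

lemma finite_symmetric_tilings: "finite (symmetric_tilings m n)"
proof (rule finite_subset)
  show "symmetric_tilings m n \<subseteq>
      Pow (centered_interval (m * n)) \<times> Pow (centered_interval (n * m))"
    by (auto dest: symmetric_tilings_swap symmetric_tiling_subset)
qed simp

subsection \<open>Tilings from factorization sequences\<close>

fun tile :: "nat list \<Rightarrow> int set" and cotile :: "nat list \<Rightarrow> int set" where
  "tile [] = {0}"
| "tile (f # fs) = centered_interval f + int f *o cotile fs"
| "cotile [] = {0}"
| "cotile (f # fs) = int f *o tile fs"

definition even_index_prod :: "nat list \<Rightarrow> nat" where
  "even_index_prod fs = (\<Prod>i<(length fs + 1) div 2. fs ! (2 * i))"

definition odd_index_prod :: "nat list \<Rightarrow> nat" where
  "odd_index_prod fs = (\<Prod>i<length fs div 2. fs ! (2 * i + 1))"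

lemma even_index_prod_Nil: "even_index_prod [] = 1"
  by (simp add: even_index_prod_def)

lemma odd_index_prod_Nil: "odd_index_prod [] = 1"
  by (simp add: odd_index_prod_def)

lemma even_index_prod_Cons: "even_index_prod (f # fs) = f * odd_index_prod fs"
  by (simp add: even_index_prod_def odd_index_prod_def prod.lessThan_Suc_shift
      del: prod.lessThan_Suc)

lemma odd_index_prod_Cons: "odd_index_prod (f # fs) = even_index_prod fs"
  by (simp add: odd_index_prod_def even_index_prod_def)

lemma tile_cotile_in_symmetric_tilings:
  assumes "\<forall>f\<in>set fs. odd f"
  shows "(tile fs, cotile fs) \<in> symmetric_tilings (even_index_prod fs) (odd_index_prod fs)"
  using assms
proof (induction fs)
  case Nil
  show ?case
    by (auto simp: symmetric_tilings_def symmetric_set_def even_index_prod_Nil odd_index_prod_Nil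
        direct_sumset_def centered_interval_def)
next
  case (Cons f fs)
  then show ?case
    using symmetric_tilings_extend[of "tile fs" "cotile fs"]
    by (simp add: even_index_prod_Cons odd_index_prod_Cons)
qed

lemma zero_mem_tile_cotile: "0 \<in> tile fs \<and> 0 \<in> cotile fs"
  by (induction fs) (force simp: set_plus_def elt_set_times_def)+

lemma one_notin_cotile:
  assumes "\<forall>f\<in>set fs. 1 < f"
  shows "1 \<notin> cotile fs"
  using assms by (cases fs) (auto simp: elt_set_times_def zmult_eq_1_iff dest!: sym[of 1])

lemma initial_segment_subset_tile_iff:
  assumes f: "odd f" and fs: "\<forall>g\<in>set fs. 1 < g"
  shows "{0..int k} \<subseteq> tile (f # fs) \<longleftrightarrow> k \<le> f div 2"
proof
  show "{0..int k} \<subseteq> tile (f # fs)" if "k \<le> f div 2"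
  proof
    fix l assume "l \<in> {0..int k}"
    with that have "l \<in> centered_interval f"
      by (auto simp: mem_centered_interval_iff)
    then have "l + int f * 0 \<in> tile (f # fs)"
      using mixed_radix_mem_iff[OF f, of l 0] zero_mem_tile_cotile by simp
    then show "l \<in> tile (f # fs)"
      by simp
  qed
  have "int f = 2 * int (f div 2) + 1"
    using f by (auto elim!: oddE)
  then have "int (f div 2 + 1) = - int (f div 2) + int f * 1"
    by simp
  also have "\<dots> \<notin> tile (f # fs)"
    using mixed_radix_mem_iff[OF f, of "- int (f div 2)" 1] one_notin_cotile[OF fs]
    by (simp add: mem_centered_interval_iff)
  finally have "\<not> {0..int k} \<subseteq> tile (f # fs)" if "\<not> k \<le> f div 2"
    using that by (auto dest!: subsetD[of _ _ "int (f div 2 + 1)"] simp del: tile.simps)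
  then show "k \<le> f div 2" if "{0..int k} \<subseteq> tile (f # fs)"
    using that by blast
qed

lemma one_mem_tile_iff:
  assumes "\<forall>f\<in>set fs. odd f \<and> 1 < f"
  shows "1 \<in> tile fs \<longleftrightarrow> fs \<noteq> []"
proof (cases fs)
  case (Cons f gs)
  with assms have "1 < f"
    by simp
  then have "1 \<le> f div 2"
    by presburger
  then have "{0..int 1} \<subseteq> tile (f # gs)"
    using assms Cons initial_segment_subset_tile_iff[of f gs 1] by (simp del: tile.simps)
  then have "1 \<in> tile (f # gs)"
    by (rule subsetD) simp
  with Cons show ?thesis by simp
qed simp

lemma tile_cotile_inject:
  assumes "\<forall>f\<in>set fs. odd f \<and> 1 < f" "\<forall>g\<in>set gs. odd g \<and> 1 < g"
    and "tile fs = tile gs" "cotile fs = cotile gs"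
  shows "fs = gs"
  using assms
proof (induction fs arbitrary: gs)
  case Nil
  then show ?case
    using one_mem_tile_iff[of gs] by (metis tile.simps(1) singletonD zero_neq_one)
next
  case (Cons f fs)
  then have "gs \<noteq> []"
    using one_mem_tile_iff[of "f # fs"] one_mem_tile_iff[of gs] by simp
  then obtain g gs' where gs: "gs = g # gs'"
    by (cases gs) auto
  have "k \<le> f div 2 \<longleftrightarrow> k \<le> g div 2" for k
    using initial_segment_subset_tile_iff[of f fs k] initial_segment_subset_tile_iff[of g gs' k]
      Cons.prems gs by (simp del: tile.simps)
  then have "f div 2 = g div 2"
    by (meson order_antisym order_refl)
  then have g: "g = f" and f: "odd f"
    using Cons.prems gs by (auto elim!: oddE)
  have "cotile fs = cotile gs'"
    using mixed_radix_cancel[OF f] Cons.prems gs g by simp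
  moreover have "tile fs = tile gs'"
    using Cons.prems gs g f elt_set_times_cancel_left[of "int f"] by auto
  ultimately show ?case
    using Cons.IH[of gs'] Cons.prems gs g by simp
qed

lemma proj_factorization_seqs_iff:
  "fs \<in> proj_factorization_seqs m n \<longleftrightarrow>
     (\<forall>f\<in>set fs. 1 < f) \<and> 2 \<le> length fs \<and> even_index_prod fs = m \<and> odd_index_prod fs = n"
proof -
  have "(\<exists>k\<ge>1. length fs = 2 * k \<and> P k \<or> length fs = 2 * k + 1 \<and> Q k) \<longleftrightarrow>
      2 \<le> length fs \<and> (if even (length fs) then P (length fs div 2) else Q (length fs div 2))"
    for P Q
    by (cases "even (length fs)")
      (auto elim!: evenE oddE simp: Suc_double_not_eq_double double_not_eq_Suc_double)
  then show ?thesis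
    unfolding proj_factorization_seqs_def even_index_prod_def odd_index_prod_def by auto
qed

lemma odd_factorization_seq:
  assumes "fs \<in> proj_factorization_seqs m n" "odd m" "odd n"
  shows "\<forall>f\<in>set fs. odd f \<and> 1 < f"
proof -
  have "odd (even_index_prod fs) \<and> odd (odd_index_prod fs) \<longleftrightarrow> (\<forall>f\<in>set fs. odd f)"
    by (induction fs)
      (auto simp: even_index_prod_Nil odd_index_prod_Nil even_index_prod_Cons odd_index_prod_Cons)
  then show ?thesis
    using assms by (auto simp: proj_factorization_seqs_iff)
qed

lemma tile_cotile_factorization_seq:
  assumes "fs \<in> proj_factorization_seqs m n" "odd m" "odd n"
  shows "(tile fs, cotile fs) \<in> symmetric_tilings m n"
  using assms tile_cotile_in_symmetric_tilings[of fs] odd_factorization_seq[OF assms]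
  by (simp add: proj_factorization_seqs_iff)

lemma inj_on_tile_cotile:
  assumes "odd m" "odd n"
  shows "inj_on (\<lambda>fs. (tile fs, cotile fs)) (proj_factorization_seqs m n)"
  using assms by (auto intro!: inj_onI tile_cotile_inject dest: odd_factorization_seq)

lemma tau_le_card_symmetric_tilings:
  assumes "odd m" "odd n"
  shows "tau m n + tau n m \<le> card (symmetric_tilings m n)"
proof -
  let ?T = "(\<lambda>fs. (tile fs, cotile fs)) ` proj_factorization_seqs m n"
  let ?U = "prod.swap ` (\<lambda>fs. (tile fs, cotile fs)) ` proj_factorization_seqs n m"
  have sub: "?T \<union> ?U \<subseteq> symmetric_tilings m n"
    using assms by (auto intro: tile_cotile_factorization_seq
        symmetric_tilings_swap[OF tile_cotile_factorization_seq])
  have "tile fs \<noteq> cotile gs"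
    if "fs \<in> proj_factorization_seqs m n" "gs \<in> proj_factorization_seqs n m" for fs gs
  proof -
    have "1 \<in> tile fs"
      using that(1) one_mem_tile_iff odd_factorization_seq[OF that(1) assms]
      by (auto simp: proj_factorization_seqs_iff)
    moreover have "1 \<notin> cotile gs"
      using that(2) by (simp add: proj_factorization_seqs_iff one_notin_cotile)
    ultimately show ?thesis by blast
  qed
  then have "?T \<inter> ?U = {}"
    by auto
  moreover have "finite ?T" "finite ?U"
    using finite_subset[OF _ finite_symmetric_tilings] sub by blast+
  moreover have "card ?T = tau m n" "card ?U = tau n m"
    using assms by (simp_all add: card_image inj_on_tile_cotile tau_def)
  ultimately have "tau m n + tau n m = card (?T \<union> ?U)"
    by (simp add: card_Un_disjoint)
  then show ?thesis
    using card_mono[OF finite_symmetric_tilings sub] by simp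
qed

subsection \<open>Signed cardinalities\<close>

definition parity_sign :: "'a::semiring_parity \<Rightarrow> int" where
  "parity_sign k = (if even k then 1 else - 1)"

definition signed_card :: "'a::semiring_parity set \<Rightarrow> int" where
  "signed_card A = (\<Sum>a\<in>A. parity_sign a)"

lemma parity_sign_add: "parity_sign (a + b) = parity_sign a * parity_sign b"
  by (simp add: parity_sign_def)

lemma signed_card_direct_sumset:
  assumes "direct_sumset A B"
  shows "signed_card (A + B) = signed_card A * signed_card B"
proof -
  have "signed_card (A + B) = (\<Sum>(a, b)\<in>A \<times> B. parity_sign (a + b))"
    unfolding signed_card_def
    using sum.reindex_bij_betw[OF bij_betw_direct_sumset[OF assms], of parity_sign]
    by (simp add: case_prod_beta)
  then show ?thesis
    by (simp add: signed_card_def parity_sign_add sum_product sum.cartesian_product)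
qed

lemma signed_card_eq:
  assumes "finite A"
  shows "signed_card A = int (card {a\<in>A. even a}) - int (card {a\<in>A. odd a})"
proof -
  have "{a\<in>A. even a} = A \<inter> {a. even a}" "{a\<in>A. odd a} = A \<inter> - {a. even a}"
    by auto
  then show ?thesis
    using assms by (simp add: signed_card_def parity_sign_def sum.If_cases)
qed

lemma abs_signed_card_centered_interval: "\<bar>signed_card (centered_interval n)\<bar> = 1"
proof -
  have "signed_card {- int p..int p} = parity_sign (int p)" for p
  proof (induction p)
    case (Suc p)
    have "{- int (Suc p)..int (Suc p)}
        = insert (int (Suc p)) (insert (- int (Suc p)) {- int p..int p})"
      by auto
    then show ?case
      using Suc by (simp add: signed_card_def parity_sign_def)
  qed (simp add: signed_card_def)
  then show ?thesis
    by (simp add: centered_interval_def parity_sign_def)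
qed

text \<open>The even and the odd elements of \<open>A\<close> form symmetric sets whose cardinalities differ
  by one; only the even ones include \<open>0\<close>.\<close>

lemma card_positive_parity_classes:
  fixes A :: "'a::{linordered_idom, semiring_parity} set"
  assumes "symmetric_set A" "odd (card A)" "\<bar>signed_card A\<bar> = 1"
  shows "card {a \<in> A \<inter> {0<..}. even a} = card A div 2 div 2"
    and "card {a \<in> A \<inter> {0<..}. odd a} = card A div 2 - card A div 2 div 2"
proof -
  have fin: "finite A"
    using assms(2) by (rule contrapos_pp) simp
  let ?E = "{a \<in> A \<inter> {0<..}. even a}" and ?D = "{a \<in> A \<inter> {0<..}. odd a}"
  have symE: "symmetric_set {a\<in>A. even a}" and symD: "symmetric_set {a\<in>A. odd a}"
    using assms(1) by (auto simp: symmetric_set_def)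
  have pos: "{a\<in>A. even a} \<inter> {0<..} = ?E" "{a\<in>A. odd a} \<inter> {0<..} = ?D"
    by auto
  have "card {a\<in>A. even a} = 1 + 2 * card ?E"
    using card_symmetric_set[OF _ symE] fin zero_mem_symmetric_set[OF assms(1,2)]
    by (simp add: pos)
  moreover have "card {a\<in>A. odd a} = 2 * card ?D"
    using card_symmetric_set[OF _ symD] fin by (simp add: pos)
  moreover have "{a\<in>A. even a} \<union> {a\<in>A. odd a} = A"
    by auto
  then have "card A = card {a\<in>A. even a} + card {a\<in>A. odd a}"
    using fin card_Un_disjoint[of "{a\<in>A. even a}" "{a\<in>A. odd a}"] by auto
  moreover have "\<bar>int (card {a\<in>A. even a}) - int (card {a\<in>A. odd a})\<bar> = 1"
    using assms(3) signed_card_eq[OF fin] by simp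
  ultimately show "card ?E = card A div 2 div 2" "card ?D = card A div 2 - card A div 2 div 2"
    by linarith+
qed

lemma abs_signed_card_symmetric_tiling:
  assumes "(A, B) \<in> symmetric_tilings m n"
  shows "\<bar>signed_card A\<bar> = 1"
proof -
  have "direct_sumset A B" "A + B = centered_interval (m * n)"
    using assms by (auto simp: symmetric_tilings_def)
  then have "signed_card (centered_interval (m * n)) = signed_card A * signed_card B"
    using signed_card_direct_sumset[of A B] by simp
  then have "\<bar>signed_card A * signed_card B\<bar> = 1"
    by (metis abs_signed_card_centered_interval)
  then show ?thesis
    by (rule abs_zmult_eq_1)
qed

subsection \<open>Parity-preserving bijections\<close>

definition ext_bijections :: "'a set \<Rightarrow> 'b set \<Rightarrow> ('a \<Rightarrow> 'b) set" where
  "ext_bijections S T = {f \<in> extensional S. bij_betw f S T}"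

lemma finite_ext_bijections:
  assumes "finite S" "finite T"
  shows "finite (ext_bijections S T)"
proof (rule finite_subset)
  show "ext_bijections S T \<subseteq> S \<rightarrow>\<^sub>E T"
    by (auto simp: ext_bijections_def PiE_def bij_betw_def)
  show "finite (S \<rightarrow>\<^sub>E T)"
    using assms by (simp add: finite_PiE)
qed

lemma card_ext_bijections:
  assumes "finite S" "finite T" "card S = card T"
  shows "card (ext_bijections S T) = fact (card S)"
proof -
  have "f ` S = T" if "f \<in> S \<rightarrow>\<^sub>E T" "inj_on f S" for f
    using that assms by (intro card_subset_eq) (auto simp: card_image)
  then have "ext_bijections S T = {f \<in> S \<rightarrow>\<^sub>E T. inj_on f S}"
    by (auto simp: ext_bijections_def PiE_def bij_betw_def)
  then show ?thesis
    using card_inj_on_subset_funcset[OF assms(1,2) order_refl] assms(3)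
    by (simp add: fact_prod_rev)
qed

definition parity_bijections ::
  "'a::semiring_parity set \<Rightarrow> 'b::semiring_parity set \<Rightarrow> ('a \<Rightarrow> 'b) set" where
  "parity_bijections S T = {f \<in> ext_bijections S T. \<forall>u\<in>S. even (f u) \<longleftrightarrow> even u}"

definition parity_glue ::
  "('a::semiring_parity \<Rightarrow> 'b) \<Rightarrow> ('a \<Rightarrow> 'b) \<Rightarrow> 'a \<Rightarrow> 'b" where
  "parity_glue e d = (\<lambda>u. if even u then e u else d u)"

lemma parity_glue_in_parity_bijections:
  assumes "e \<in> ext_bijections {u\<in>S. even u} {v\<in>T. even v}"
    and "d \<in> ext_bijections {u\<in>S. odd u} {v\<in>T. odd v}"
  shows "parity_glue e d \<in> parity_bijections S T"
proof -
  let ?SE = "{u\<in>S. even u}" and ?SD = "{u\<in>S. odd u}"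
  let ?TE = "{v\<in>T. even v}" and ?TD = "{v\<in>T. odd v}"
  have e: "bij_betw e ?SE ?TE" and d: "bij_betw d ?SD ?TD"
    and ext: "e \<in> extensional ?SE" "d \<in> extensional ?SD"
    using assms by (auto simp: ext_bijections_def)
  have "bij_betw (parity_glue e d) ?SE ?TE"
    using e by (subst bij_betw_cong[of _ _ e]) (auto simp: parity_glue_def)
  moreover have "bij_betw (parity_glue e d) ?SD ?TD"
    using d by (subst bij_betw_cong[of _ _ d]) (auto simp: parity_glue_def)
  ultimately have "bij_betw (parity_glue e d) (?SE \<union> ?SD) (?TE \<union> ?TD)"
    by (rule bij_betw_combine) auto
  moreover have "?SE \<union> ?SD = S" "?TE \<union> ?TD = T"
    by auto
  moreover have "parity_glue e d \<in> extensional S"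
    using ext by (auto simp: parity_glue_def extensional_def)
  moreover have "even (parity_glue e d u) \<longleftrightarrow> even u" if "u \<in> S" for u
    using that bij_betwE[OF e] bij_betwE[OF d] by (auto simp: parity_glue_def)
  ultimately show ?thesis
    by (simp add: parity_bijections_def ext_bijections_def)
qed

lemma card_parity_bijections_ge:
  assumes fin: "finite S" "finite T"
    and even: "card {u\<in>S. even u} = card {v\<in>T. even v}"
    and odd: "card {u\<in>S. odd u} = card {v\<in>T. odd v}"
  shows "fact (card {u\<in>S. even u}) * fact (card {u\<in>S. odd u}) \<le> card (parity_bijections S T)"
proof -
  let ?SE = "{u\<in>S. even u}" and ?SD = "{u\<in>S. odd u}"
  let ?X = "ext_bijections ?SE {v\<in>T. even v} \<times> ext_bijections ?SD {v\<in>T. odd v}"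
  let ?f = "\<lambda>(e, d). parity_glue e d"
  have "(restrict (?f x) ?SE, restrict (?f x) ?SD) = x" if "x \<in> ?X" for x
    using that by (auto simp: parity_glue_def ext_bijections_def fun_eq_iff extensional_def)
  then have "inj_on ?f ?X"
    by (rule inj_on_inverseI[where g = "\<lambda>h. (restrict h ?SE, restrict h ?SD)"])
  moreover have "?f ` ?X \<subseteq> parity_bijections S T"
    by (auto intro: parity_glue_in_parity_bijections)
  moreover have "finite (parity_bijections S T)"
    using finite_ext_bijections[OF fin] by (simp add: parity_bijections_def)
  ultimately have "card ?X \<le> card (parity_bijections S T)"
    by (rule card_inj_on_le)
  then show ?thesis
    using fin even odd by (simp add: card_cartesian_product card_ext_bijections)
qed

subsection \<open>Odd arrangements\<close>

definition odd_arrangements :: "nat \<Rightarrow> int set \<Rightarrow> (int \<Rightarrow> int) set" where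
  "odd_arrangements m A =
     {P \<in> parity_bijections (centered_interval m) A. \<forall>u\<in>centered_interval m. P (- u) = - P u}"

lemma finite_odd_arrangements: "finite A \<Longrightarrow> finite (odd_arrangements m A)"
  using finite_ext_bijections[of "centered_interval m" A]
  by (simp add: odd_arrangements_def parity_bijections_def)

lemma odd_arrangementsD:
  assumes "P \<in> odd_arrangements m A"
  shows "P \<in> extensional (centered_interval m)" "bij_betw P (centered_interval m) A"
    and "\<And>u. u \<in> centered_interval m \<Longrightarrow> P (- u) = - P u"
    and "\<And>u. u \<in> centered_interval m \<Longrightarrow> even (P u) \<longleftrightarrow> even u"
  using assms by (auto simp: odd_arrangements_def parity_bijections_def ext_bijections_def)

lemma odd_arrangements_disjoint:
  assumes "A \<noteq> A'"
  shows "odd_arrangements m A \<inter> odd_arrangements m A' = {}"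
  using assms by (auto dest!: odd_arrangementsD(2) simp: bij_betw_def)

lemma odd_arrangement_zero: "P \<in> odd_arrangements m A \<Longrightarrow> P 0 = 0"
  using odd_arrangementsD(3)[of P m A 0] by simp

definition signed_extension :: "nat \<Rightarrow> (int \<Rightarrow> int) \<Rightarrow> int set \<Rightarrow> int \<Rightarrow> int" where
  "signed_extension m g T =
     (\<lambda>u\<in>centered_interval m. sgn u * (if \<bar>u\<bar> \<in> T then - g \<bar>u\<bar> else g \<bar>u\<bar>))"

lemma positive_centered_interval: "centered_interval m \<inter> {0<..} = {1..int (m div 2)}"
  by (auto simp: centered_interval_def)

lemma signed_extension_minus:
  "u \<in> centered_interval m \<Longrightarrow> signed_extension m g T (- u) = - signed_extension m g T u"
  by (auto simp: signed_extension_def mem_centered_interval_iff sgn_minus)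

lemma signed_extension_zero: "signed_extension m g T 0 = 0"
  by (simp add: signed_extension_def)

lemma abs_signed_extension:
  assumes "u \<in> centered_interval m" "u \<noteq> 0" "g \<bar>u\<bar> > 0"
  shows "\<bar>signed_extension m g T u\<bar> = g \<bar>u\<bar>"
  using assms by (auto simp: signed_extension_def abs_mult)

lemma signed_extension_image:
  assumes g: "g ` (centered_interval m \<inter> {0<..}) = A \<inter> {0<..}"
    and A: "symmetric_set A" "0 \<in> A"
  shows "signed_extension m g T ` centered_interval m = A"
proof (intro equalityI subsetI)
  let ?P = "signed_extension m g T" and ?I = "centered_interval m"
  have abs_mem: "\<bar>a\<bar> \<in> A \<longleftrightarrow> a \<in> A" for a
    using A(1) by (auto simp: symmetric_set_def abs_if dest: bspec[of _ _ "- a"])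
  have abs_P: "\<bar>?P u\<bar> = g \<bar>u\<bar>" "g \<bar>u\<bar> \<in> A" if "u \<in> ?I" "u \<noteq> 0" for u
  proof -
    have "\<bar>u\<bar> \<in> ?I \<inter> {0<..}"
      using that by (auto simp: mem_centered_interval_iff)
    with g have "g \<bar>u\<bar> \<in> A \<inter> {0<..}"
      by blast
    with that show "\<bar>?P u\<bar> = g \<bar>u\<bar>" "g \<bar>u\<bar> \<in> A"
      by (simp_all add: abs_signed_extension)
  qed
  show "a \<in> A" if "a \<in> ?P ` ?I" for a
  proof -
    obtain u where "u \<in> ?I" "a = ?P u"
      using \<open>a \<in> ?P ` ?I\<close> by blast
    then show ?thesis
      using abs_P abs_mem signed_extension_zero A(2) by (cases "u = 0") metis+
  qed
  show "a \<in> ?P ` ?I" if "a \<in> A" for a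
  proof (cases "a = 0")
    case True
    then show ?thesis
      by (metis image_eqI signed_extension_zero zero_mem_centered_interval)
  next
    case False
    with \<open>a \<in> A\<close> abs_mem have "\<bar>a\<bar> \<in> g ` (?I \<inter> {0<..})"
      by (simp add: g)
    then obtain u where u: "u \<in> ?I" "u > 0" "g u = \<bar>a\<bar>"
      by auto
    then have "a = ?P u \<or> a = ?P (- u)"
      using abs_P(1)[of u] signed_extension_minus[of u m g T] by auto
    moreover have "- u \<in> ?I"
      using u(1) by (simp add: mem_centered_interval_iff)
    ultimately show ?thesis
      using u(1) by blast
  qed
qed

lemma signed_extension_in_odd_arrangements:
  assumes g: "g \<in> parity_bijections (centered_interval m \<inter> {0<..}) (A \<inter> {0<..})"
    and A: "symmetric_set A" "card A = m" "odd m"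
  shows "signed_extension m g T \<in> odd_arrangements m A"
proof -
  let ?P = "signed_extension m g T" and ?I = "centered_interval m"
  have bij: "bij_betw g (?I \<inter> {0<..}) (A \<inter> {0<..})"
    using g by (simp add: parity_bijections_def ext_bijections_def)
  have "0 \<in> A"
    using zero_mem_symmetric_set A by blast
  then have "?P ` ?I = A"
    using bij_betw_imp_surj_on[OF bij] A(1) by (intro signed_extension_image)
  moreover have "card ?I = card A"
    using A by (simp add: card_centered_interval)
  ultimately have "bij_betw ?P ?I A"
    by (metis bij_betw_def eq_card_imp_inj_on finite_centered_interval)
  moreover have "even (?P u) \<longleftrightarrow> even u" if "u \<in> ?I" for u
  proof (cases "u = 0")
    case False
    with that have "\<bar>u\<bar> \<in> ?I \<inter> {0<..}"
      by (auto simp: mem_centered_interval_iff)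
    then have "g \<bar>u\<bar> > 0" "even (g \<bar>u\<bar>) \<longleftrightarrow> even \<bar>u\<bar>"
      using bij_betwE[OF bij] g by (auto simp: parity_bijections_def)
    then show ?thesis
      using abs_signed_extension[OF that False] by (metis dvd_abs_iff)
  qed (simp add: signed_extension_zero)
  moreover have "?P \<in> extensional ?I"
    by (simp add: signed_extension_def)
  ultimately show ?thesis
    by (simp add: odd_arrangements_def parity_bijections_def ext_bijections_def
        signed_extension_minus)
qed

lemma card_odd_arrangements_ge_parity_bijections:
  assumes "symmetric_set A" "card A = m" "odd m"
  shows "2 ^ (m div 2) * card (parity_bijections (centered_interval m \<inter> {0<..}) (A \<inter> {0<..}))
    \<le> card (odd_arrangements m A)"
proof -
  let ?I = "centered_interval m \<inter> {0<..}"
  let ?G = "parity_bijections ?I (A \<inter> {0<..})"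
  let ?f = "\<lambda>(g, T). signed_extension m g T"
  let ?h = "\<lambda>P. (\<lambda>u\<in>?I. \<bar>P u\<bar>, {u\<in>?I. P u < (0::int)})"
  have inverse: "?h (signed_extension m g T) = (g, T)" if g: "g \<in> ?G" and T: "T \<subseteq> ?I" for g T
  proof -
    have pos: "g u > 0" if "u \<in> ?I" for u
      using g that by (auto simp: parity_bijections_def ext_bijections_def dest!: bij_betwE)
    have "(\<lambda>u\<in>?I. \<bar>signed_extension m g T u\<bar>) = g"
      using g pos by (intro extensionalityI[of _ ?I])
        (auto simp: signed_extension_def parity_bijections_def ext_bijections_def less_imp_le)
    moreover have "{u\<in>?I. signed_extension m g T u < 0} = T"
      using T pos by (auto simp: signed_extension_def split: if_splits) (meson less_asym)
    ultimately show ?thesis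
      by simp
  qed
  have "inj_on ?f (?G \<times> Pow ?I)"
  proof (rule inj_on_inverseI[where g = ?h])
    fix x assume "x \<in> ?G \<times> Pow ?I"
    then show "?h (?f x) = x"
      by (cases x) (simp only: mem_Times_iff fst_conv snd_conv Pow_iff prod.case inverse)
  qed
  moreover have "?f ` (?G \<times> Pow ?I) \<subseteq> odd_arrangements m A"
    using signed_extension_in_odd_arrangements[OF _ assms] by auto
  moreover have "finite (odd_arrangements m A)"
    using assms(2,3) by (intro finite_odd_arrangements card_ge_0_finite) (simp add: odd_pos)
  ultimately have "card (?G \<times> Pow ?I) \<le> card (odd_arrangements m A)"
    by (rule card_inj_on_le)
  then show ?thesis
    by (simp add: card_cartesian_product card_Pow positive_centered_interval mult.commute)
qed

lemma beta_altdef: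
  assumes "odd m"
  shows "beta m = fact (m div 2 div 2) * fact (m div 2 - m div 2 div 2)"
proof -
  have "m mod 4 = 1 \<or> m mod 4 = 3"
    using assms by presburger
  then consider (one_mod_4) k where "m = 4 * k + 1" | (three_mod_4) k where "m = 4 * k + 3"
    by (metis mult_div_mod_eq)
  then show ?thesis
  proof cases
    case (one_mod_4 k)
    then have "m mod 4 = 1" "(m - 1) div 4 = k" "m div 2 = 2 * k" by auto
    then show ?thesis by (simp add: beta_def power2_eq_square)
  next
    case (three_mod_4 k)
    then have "m mod 4 = 3" "(m - 3) div 4 = k" "(m + 1) div 4 = k + 1" "m div 2 = 2 * k + 1"
      by auto
    then show ?thesis by (simp add: beta_def)
  qed
qed

lemma card_odd_arrangements_ge:
  assumes "(A, B) \<in> symmetric_tilings m n"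
  shows "2 ^ (m div 2) * beta m \<le> card (odd_arrangements m A)"
proof -
  let ?I = "centered_interval m"
  have A: "symmetric_set A" "card A = m" and m: "odd m"
    using assms odd_mult_symmetric_tiling[OF assms] by (auto simp: symmetric_tilings_def)
  have I: "symmetric_set ?I" "card ?I = m"
    using m by (simp_all add: symmetric_centered_interval card_centered_interval)
  have classes: "card {a \<in> C \<inter> {0<..}. even a} = m div 2 div 2"
    "card {a \<in> C \<inter> {0<..}. odd a} = m div 2 - m div 2 div 2" if "C \<in> {?I, A}" for C
    using that A I m card_positive_parity_classes[of C]
      abs_signed_card_centered_interval abs_signed_card_symmetric_tiling[OF assms]
    by auto
  have "beta m \<le> card (parity_bijections (?I \<inter> {0<..}) (A \<inter> {0<..}))"
    using card_parity_bijections_ge[of "?I \<inter> {0<..}" "A \<inter> {0<..}"] classes[of ?I] classes[of A]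
      finite_symmetric_tiling[OF assms] beta_altdef[OF m]
    by simp
  then show ?thesis
    using card_odd_arrangements_ge_parity_bijections[OF A m] mult_le_mono2 order_trans by blast
qed

subsection \<open>The zigzag numbering\<close>

definition zigzag :: "nat \<Rightarrow> int \<Rightarrow> nat" where
  "zigzag N c = nat (if even c then c div 2 + 1 else int N - c div 2)"

lemma int_zigzag:
  assumes "c \<in> {0..<int N}"
  shows "2 * int (zigzag N c) = (if even c then c + 2 else 2 * int N - c + 1)"
  using assms by (auto simp: zigzag_def elim!: evenE oddE)

lemma bij_betw_zigzag: "bij_betw (zigzag N) {0..<int N} {1..N}"
proof -
  have inj: "inj_on (zigzag N) {0..<int N}"
  proof (rule inj_onI)
    fix c d assume c: "c \<in> {0..<int N}" and d: "d \<in> {0..<int N}" and "zigzag N c = zigzag N d"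
    then have "(if even c then c + 2 else 2 * int N - c + 1)
        = (if even d then d + 2 else 2 * int N - d + 1)"
      using int_zigzag[OF c] int_zigzag[OF d] by simp
    then show "c = d"
      using c d by (auto split: if_splits)
  qed
  have "zigzag N c \<in> {1..N}" if c: "c \<in> {0..<int N}" for c
    using int_zigzag[OF c] c by (auto split: if_splits)
  then have "zigzag N ` {0..<int N} \<subseteq> {1..N}"
    by blast
  then have "zigzag N ` {0..<int N} = {1..N}"
    by (intro card_subset_eq) (simp_all add: card_image[OF inj])
  with inj show ?thesis by (simp add: bij_betw_def)
qed

lemma sum_zigzag:
  assumes "{w, x, y, z} \<subseteq> {0..<int N}"
    and "w + z = x + y" "even w \<longleftrightarrow> even z" "even x \<longleftrightarrow> odd w"
  shows "zigzag N w + zigzag N x + zigzag N y + zigzag N z = 2 * N + 3"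
proof -
  have "even y \<longleftrightarrow> odd w"
    using assms(2-4) by presburger
  then have "int (zigzag N w + zigzag N x + zigzag N y + zigzag N z) = int (2 * N + 3)"
    using assms int_zigzag[of w N] int_zigzag[of x N] int_zigzag[of y N] int_zigzag[of z N]
    by (cases "even w") auto
  then show ?thesis
    by (simp only: of_nat_eq_iff)
qed

subsection \<open>Labelings from arrangements\<close>

definition offset :: "nat \<Rightarrow> nat \<Rightarrow> int" where
  "offset m i = int i - int (m div 2) - 1"

lemma bij_betw_offset:
  assumes "odd m"
  shows "bij_betw (offset m) {1..m} (centered_interval m)"
proof -
  have "int m = 2 * int (m div 2) + 1"
    using assms by (auto elim!: oddE)
  then show ?thesis
    by (intro bij_betwI[where g = "\<lambda>u. nat (u + int (m div 2) + 1)"])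
       (auto simp: offset_def centered_interval_def)
qed

lemma offset_reflect:
  assumes "odd m" "i \<in> {1..m}"
  shows "offset m (m + 1 - i) = - offset m i"
  using assms by (auto simp: offset_def elim!: oddE)

lemma odd_arrangement_reflect:
  assumes "P \<in> odd_arrangements m A" "odd m" "i \<in> {1..m}"
  shows "P (offset m (m + 1 - i)) = - P (offset m i)"
  using odd_arrangementsD(3)[OF assms(1)] bij_betwE[OF bij_betw_offset] offset_reflect assms
  by simp

lemma odd_arrangement_alternates:
  assumes "P \<in> odd_arrangements m A" "odd m" "i \<in> {1..m - 1}"
  shows "even (P (offset m (i + 1))) \<longleftrightarrow> odd (P (offset m i))"
proof -
  have "offset m i \<in> centered_interval m" "offset m (i + 1) \<in> centered_interval m"
    using bij_betwE[OF bij_betw_offset[OF assms(2)]] assms(3) by auto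
  then show ?thesis
    using odd_arrangementsD(4)[OF assms(1)] by (simp add: offset_def)
qed

definition arrangement_pairs :: "nat \<Rightarrow> nat \<Rightarrow> ((int \<Rightarrow> int) \<times> (int \<Rightarrow> int)) set" where
  "arrangement_pairs m n =
     (\<Union>(A, B)\<in>symmetric_tilings m n. odd_arrangements m A \<times> odd_arrangements n B)"

lemma arrangement_pairsE:
  assumes "PQ \<in> arrangement_pairs m n"
  obtains P Q A B where "PQ = (P, Q)" "(A, B) \<in> symmetric_tilings m n"
    "P \<in> odd_arrangements m A" "Q \<in> odd_arrangements n B"
  using assms by (auto simp: arrangement_pairs_def)

lemma card_arrangement_pairs_ge:
  assumes "odd m" "odd n"
  shows "(tau m n + tau n m) * ((2 ^ (m div 2) * beta m) * (2 ^ (n div 2) * beta n))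
    \<le> card (arrangement_pairs m n)"
proof -
  let ?T = "symmetric_tilings m n"
  let ?X = "\<lambda>(A, B). odd_arrangements m A \<times> odd_arrangements n B"
  let ?b = "(2 ^ (m div 2) * beta m) * (2 ^ (n div 2) * beta n)"
  have finX: "finite (?X t)" if "t \<in> ?T" for t
    using that by (cases t) (auto intro!: finite_odd_arrangements finite_symmetric_tiling
        dest: symmetric_tilings_swap)
  have disj: "?X s \<inter> ?X t = {}" if "s \<noteq> t" for s t
    using that odd_arrangements_disjoint[of "fst s" "fst t" m]
      odd_arrangements_disjoint[of "snd s" "snd t" n]
    by (cases s, cases t) auto
  have "?b \<le> card (?X t)" if t: "t \<in> ?T" for t
    using t by (cases t) (auto simp: card_cartesian_product
        intro!: mult_le_mono card_odd_arrangements_ge dest: symmetric_tilings_swap)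
  then have "card ?T * ?b \<le> (\<Sum>t\<in>?T. card (?X t))"
    using sum_bounded_below[of ?T ?b "\<lambda>t. card (?X t)"] by simp
  also have "\<dots> = card (arrangement_pairs m n)"
    unfolding arrangement_pairs_def using finX disj
    by (subst card_UN_disjoint) (auto simp: finite_symmetric_tilings)
  finally show ?thesis
    using mult_le_mono1[OF tau_le_card_symmetric_tilings[OF assms], of ?b]
    by (rule order_trans[rotated])
qed

definition grid_value :: "nat \<Rightarrow> nat \<Rightarrow> (int \<Rightarrow> int) \<times> (int \<Rightarrow> int) \<Rightarrow> nat \<times> nat \<Rightarrow> int" where
  "grid_value m n = (\<lambda>(P, Q) (i, j). int (m * n div 2) + P (offset m i) + Q (offset n j))"

definition arrangement_labeling ::
  "nat \<Rightarrow> nat \<Rightarrow> (int \<Rightarrow> int) \<times> (int \<Rightarrow> int) \<Rightarrow> nat \<times> nat \<Rightarrow> nat" where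
  "arrangement_labeling m n PQ =
     restrict (zigzag (m * n) \<circ> grid_value m n PQ) (proj_vertices m n)"

lemma bij_betw_grid_value:
  assumes "odd m" "odd n" "PQ \<in> arrangement_pairs m n"
  shows "bij_betw (grid_value m n PQ) (proj_vertices m n) {0..<int (m * n)}"
proof -
  obtain P Q A B where PQ: "PQ = (P, Q)" and t: "(A, B) \<in> symmetric_tilings m n"
    and arr: "P \<in> odd_arrangements m A" "Q \<in> odd_arrangements n B"
    using assms(3) by (rule arrangement_pairsE)
  let ?H = "int (m * n div 2)"
  let ?rc = "map_prod (P \<circ> offset m) (Q \<circ> offset n)"
  have "bij_betw (P \<circ> offset m) {1..m} A" "bij_betw (Q \<circ> offset n) {1..n} B"
    using arr assms(1,2) by (blast intro: bij_betw_trans bij_betw_offset odd_arrangementsD)+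
  then have "bij_betw ?rc (proj_vertices m n) (A \<times> B)"
    by (simp add: proj_vertices_def bij_betw_def map_prod_inj_on map_prod_surj_on)
  moreover have "bij_betw (\<lambda>(a, b). a + b) (A \<times> B) (centered_interval (m * n))"
    using t bij_betw_direct_sumset[of A B] by (simp add: symmetric_tilings_def)
  moreover have "int (m * n) = 2 * ?H + 1"
    using assms(1,2) by (metis even_mult_iff int_ops(2,7) int_plus of_nat_numeral
        odd_two_times_div_two_succ)
  then have "bij_betw ((+) ?H) (centered_interval (m * n)) {0..<int (m * n)}"
    by (intro bij_betwI[where g = "\<lambda>x. x - ?H"]) (auto simp: centered_interval_def)
  moreover have "grid_value m n PQ = (+) ?H \<circ> ((\<lambda>(a, b). a + b) \<circ> ?rc)"
    by (auto simp: grid_value_def PQ fun_eq_iff)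
  ultimately show ?thesis
    by (auto intro: bij_betw_trans)
qed

lemma grid_value_antipode:
  assumes "odd m" "odd n" "PQ \<in> arrangement_pairs m n" "i \<in> {1..m}" "j \<in> {1..n}"
  shows "grid_value m n PQ (i, j) + grid_value m n PQ (m + 1 - i, n + 1 - j)
    = 2 * int (m * n div 2)"
proof -
  obtain P Q A B where PQ: "PQ = (P, Q)"
    and arr: "P \<in> odd_arrangements m A" "Q \<in> odd_arrangements n B"
    using assms(3) by (rule arrangement_pairsE)
  show ?thesis
    using odd_arrangement_reflect[OF arr(1) assms(1,4)]
      odd_arrangement_reflect[OF arr(2) assms(2,5)]
    by (simp add: grid_value_def PQ)
qed

lemma even_grid_value_step:
  assumes "odd m" "odd n" "PQ \<in> arrangement_pairs m n"
  shows "i \<in> {1..m - 1} \<Longrightarrow> even (grid_value m n PQ (i + 1, j)) \<longleftrightarrow> odd (grid_value m n PQ (i, j))"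
    and "j \<in> {1..n - 1} \<Longrightarrow> even (grid_value m n PQ (i, j + 1)) \<longleftrightarrow> odd (grid_value m n PQ (i, j))"
proof -
  obtain P Q A B where PQ: "PQ = (P, Q)"
    and arr: "P \<in> odd_arrangements m A" "Q \<in> odd_arrangements n B"
    using assms(3) by (rule arrangement_pairsE)
  show "even (grid_value m n PQ (i + 1, j)) \<longleftrightarrow> odd (grid_value m n PQ (i, j))" if "i \<in> {1..m - 1}"
    using odd_arrangement_alternates[OF arr(1) assms(1) that] by (auto simp: grid_value_def PQ)
  show "even (grid_value m n PQ (i, j + 1)) \<longleftrightarrow> odd (grid_value m n PQ (i, j))" if "j \<in> {1..n - 1}"
    using odd_arrangement_alternates[OF arr(2) assms(2) that] by (auto simp: grid_value_def PQ)
qed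

lemma card_proj_C4_face:
  assumes "F \<in> proj_C4_faces m n" "m > 1" "n > 1"
  shows "card F = 4"
  using assms by (auto simp: proj_C4_faces_def card_insert_if)

lemma proj_C4_face_subset:
  assumes "F \<in> proj_C4_faces m n" "m > 1" "n > 1"
  shows "F \<subseteq> proj_vertices m n"
  using assms by (auto simp: proj_C4_faces_def proj_vertices_def)

lemma proj_C4_faceE:
  assumes "F \<in> proj_C4_faces m n"
  obtains
    (interior) i j where "F = {(i, j), (i + 1, j), (i, j + 1), (i + 1, j + 1)}"
      "i \<in> {1..m - 1}" "j \<in> {1..n - 1}"
  | (right) i where "F = {(i, n), (i + 1, n), (m + 1 - i, 1), (m - i, 1)}" "i \<in> {1..m - 1}"
  | (bottom) j where "F = {(m, j), (m, j + 1), (1, n + 1 - j), (1, n - j)}" "j \<in> {1..n - 1}"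
  using assms unfolding proj_C4_faces_def by blast

text \<open>On the squares crossing a seam the two equal sums come from antipodal pairs.\<close>

lemma proj_C4_face_grid_values:
  assumes mn: "odd m" "odd n"
    and PQ: "PQ \<in> arrangement_pairs m n" and F: "F \<in> proj_C4_faces m n"
  obtains w x y z where "F = {w, x, y, z}"
    "grid_value m n PQ w + grid_value m n PQ z = grid_value m n PQ x + grid_value m n PQ y"
    "even (grid_value m n PQ w) \<longleftrightarrow> even (grid_value m n PQ z)"
    "even (grid_value m n PQ x) \<longleftrightarrow> odd (grid_value m n PQ w)"
proof -
  let ?c = "grid_value m n PQ"
  note antipode = grid_value_antipode[OF mn PQ] and step = even_grid_value_step[OF mn PQ]
  from F show thesis
  proof (cases rule: proj_C4_faceE)
    case (interior i j)
    have "?c (i, j) + ?c (i + 1, j + 1) = ?c (i + 1, j) + ?c (i, j + 1)"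
      by (simp add: grid_value_def split: prod.split)
    moreover have "even (?c (i, j)) \<longleftrightarrow> even (?c (i + 1, j + 1))"
      using step interior(2,3) by blast
    ultimately show thesis
      using that[OF interior(1)] step(1) interior(2) by blast
  next
    case (right i)
    have face: "F = {(i, n), (i + 1, n), (m - i, 1), (m + 1 - i, 1)}"
      unfolding right(1) by auto
    have sums: "?c (i, n) + ?c (m + 1 - i, 1) = 2 * int (m * n div 2)"
      "?c (i + 1, n) + ?c (m - i, 1) = 2 * int (m * n div 2)"
      using antipode[of i n] antipode[of "i + 1" n] right(2) odd_pos[OF mn(2)] by auto
    then have "even (?c (i, n)) \<longleftrightarrow> even (?c (m + 1 - i, 1))"
      by presburger
    then show thesis
      using that[OF face] sums step(1) right(2) by simp
  next
    case (bottom j)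
    have face: "F = {(m, j), (m, j + 1), (1, n - j), (1, n + 1 - j)}"
      unfolding bottom(1) by auto
    have sums: "?c (m, j) + ?c (1, n + 1 - j) = 2 * int (m * n div 2)"
      "?c (m, j + 1) + ?c (1, n - j) = 2 * int (m * n div 2)"
      using antipode[of m j] antipode[of m "j + 1"] bottom(2) odd_pos[OF mn(1)] by auto
    then have "even (?c (m, j)) \<longleftrightarrow> even (?c (1, n + 1 - j))"
      by presburger
    then show thesis
      using that[OF face] sums step(2) bottom(2) by simp
  qed
qed

lemma arrangement_labeling_in_C4_face_magic_labelings:
  assumes mn: "odd m" "odd n" "m > 1" "n > 1" and PQ: "PQ \<in> arrangement_pairs m n"
  shows "arrangement_labeling m n PQ \<in> C4_face_magic_labelings m n (2 * m * n + 3)"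
proof -
  let ?V = "proj_vertices m n" and ?f = "arrangement_labeling m n PQ" and ?c = "grid_value m n PQ"
  have bij_c: "bij_betw ?c ?V {0..<int (m * n)}"
    using mn(1,2) PQ by (rule bij_betw_grid_value)
  have "bij_betw (zigzag (m * n) \<circ> ?c) ?V {1..m * n}"
    using bij_c bij_betw_zigzag by (rule bij_betw_trans)
  then have "bij_betw ?f ?V {1..m * n}"
    by (subst bij_betw_cong[of _ _ "zigzag (m * n) \<circ> ?c"]) (simp_all add: arrangement_labeling_def)
  moreover have "(\<Sum>v\<in>F. ?f v) = 2 * m * n + 3" if F: "F \<in> proj_C4_faces m n" for F
  proof -
    obtain w x y z where face: "F = {w, x, y, z}"
      and balanced: "?c w + ?c z = ?c x + ?c y"
        "even (?c w) \<longleftrightarrow> even (?c z)" "even (?c x) \<longleftrightarrow> odd (?c w)"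
      using mn(1,2) PQ F by (rule proj_C4_face_grid_values)
    have V: "{w, x, y, z} \<subseteq> ?V"
      using proj_C4_face_subset[OF F mn(3,4)] face by simp
    have "distinct [w, x, y, z]"
      using card_proj_C4_face[OF F mn(3,4)] unfolding face by (intro card_distinct) simp
    then have "(\<Sum>v\<in>F. ?f v) = zigzag (m * n) (?c w) + zigzag (m * n) (?c x)
        + zigzag (m * n) (?c y) + zigzag (m * n) (?c z)"
      using V by (simp add: face arrangement_labeling_def)
    also have "\<dots> = 2 * (m * n) + 3"
      using V bij_betwE[OF bij_c] balanced by (intro sum_zigzag) auto
    finally show ?thesis
      by simp
  qed
  ultimately show ?thesis
    by (simp add: C4_face_magic_labelings_def arrangement_labeling_def)
qed

lemma inj_on_grid_value:
  assumes "odd m" "odd n"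
  shows "inj_on (\<lambda>PQ. restrict (grid_value m n PQ) (proj_vertices m n)) (arrangement_pairs m n)"
proof (rule inj_onI, clarify)
  fix P Q P' Q'
  assume pairs: "(P, Q) \<in> arrangement_pairs m n" "(P', Q') \<in> arrangement_pairs m n"
    and eq: "restrict (grid_value m n (P, Q)) (proj_vertices m n)
      = restrict (grid_value m n (P', Q')) (proj_vertices m n)"
  have sums: "P u + Q v = P' u + Q' v"
    if uv: "u \<in> centered_interval m" "v \<in> centered_interval n" for u v
  proof -
    obtain i j where "i \<in> {1..m}" "j \<in> {1..n}" "offset m i = u" "offset n j = v"
      using uv bij_betw_imp_surj_on[OF bij_betw_offset[OF assms(1)]]
        bij_betw_imp_surj_on[OF bij_betw_offset[OF assms(2)]]
      by (metis imageE)
    then show ?thesis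
      using fun_cong[OF eq, of "(i, j)"] by (simp add: proj_vertices_def grid_value_def)
  qed
  have zero: "P 0 = 0" "P' 0 = 0" "Q 0 = 0" "Q' 0 = 0"
    and ext: "P \<in> extensional (centered_interval m)" "P' \<in> extensional (centered_interval m)"
      "Q \<in> extensional (centered_interval n)" "Q' \<in> extensional (centered_interval n)"
    using pairs by (auto elim!: arrangement_pairsE dest: odd_arrangement_zero odd_arrangementsD(1))
  have "P = P'"
    using ext(1,2) sums[of _ 0] zero by (intro extensionalityI) auto
  moreover have "Q = Q'"
    using ext(3,4) sums[of 0] zero by (intro extensionalityI) auto
  ultimately show "P = P' \<and> Q = Q'" ..
qed

lemma inj_on_arrangement_labeling:
  assumes "odd m" "odd n"
  shows "inj_on (arrangement_labeling m n) (arrangement_pairs m n)"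
proof (rule inj_onI)
  fix x y
  assume pairs: "x \<in> arrangement_pairs m n" "y \<in> arrangement_pairs m n"
    and eq: "arrangement_labeling m n x = arrangement_labeling m n y"
  have "grid_value m n x v = grid_value m n y v" if v: "v \<in> proj_vertices m n" for v
  proof (rule inj_onD[OF bij_betw_imp_inj_on[OF bij_betw_zigzag]])
    show "zigzag (m * n) (grid_value m n x v) = zigzag (m * n) (grid_value m n y v)"
      using fun_cong[OF eq, of v] v by (simp add: arrangement_labeling_def)
  qed (use pairs v assms bij_betw_grid_value bij_betwE in blast)+
  then show "x = y"
    using inj_onD[OF inj_on_grid_value[OF assms] _ pairs] by (simp add: restrict_def fun_eq_iff)
qed

subsection \<open>Counting labelings up to symmetry\<close>

lemma C4_face_magic_labelings_alt:
  "C4_face_magic_labelings m n S =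
     {f \<in> ext_bijections (proj_vertices m n) {1..m * n}. \<forall>F\<in>proj_C4_faces m n. (\<Sum>v\<in>F. f v) = S}"
  by (auto simp: C4_face_magic_labelings_def ext_bijections_def)

lemma finite_C4_face_magic_labelings: "finite (C4_face_magic_labelings m n S)"
  by (simp add: C4_face_magic_labelings_alt finite_ext_bijections proj_vertices_def)

lemma card_C4_face_magic_labelings_ge:
  assumes mn: "odd m" "odd n" "m > 1" "n > 1"
  shows "(tau m n + tau n m) * ((2 ^ (m div 2) * beta m) * (2 ^ (n div 2) * beta n))
    \<le> card (C4_face_magic_labelings m n (2 * m * n + 3))"
  using card_arrangement_pairs_ge[OF mn(1,2)]
proof (rule order_trans)
  show "card (arrangement_pairs m n) \<le> card (C4_face_magic_labelings m n (2 * m * n + 3))"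
    using inj_on_arrangement_labeling[OF mn(1,2)] finite_C4_face_magic_labelings
      arrangement_labeling_in_C4_face_magic_labelings[OF mn]
    by (intro card_inj_on_le[of "arrangement_labeling m n"]) auto
qed

definition complement_labeling :: "nat \<Rightarrow> nat \<Rightarrow> (nat \<times> nat \<Rightarrow> nat) \<Rightarrow> nat \<times> nat \<Rightarrow> nat" where
  "complement_labeling m n f = (\<lambda>v\<in>proj_vertices m n. m * n + 1 - f v)"

lemma complement_labeling_in_C4_face_magic_labelings:
  assumes mn: "m > 1" "n > 1" and f: "f \<in> C4_face_magic_labelings m n S"
  shows "complement_labeling m n f \<in> C4_face_magic_labelings m n (4 * (m * n + 1) - S)"
proof -
  let ?V = "proj_vertices m n" and ?g = "complement_labeling m n f"
  have bij: "bij_betw f ?V {1..m * n}"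
    and sum: "\<And>F. F \<in> proj_C4_faces m n \<Longrightarrow> (\<Sum>v\<in>F. f v) = S"
    using f by (auto simp: C4_face_magic_labelings_def)
  have "bij_betw (\<lambda>x. m * n + 1 - x) {1..m * n} {1..m * n}"
    by (rule bij_betwI[where g = "\<lambda>x. m * n + 1 - x"]) auto
  from bij_betw_trans[OF bij this] have "bij_betw ?g ?V {1..m * n}"
    by (subst bij_betw_cong[of _ _ "(\<lambda>x. m * n + 1 - x) \<circ> f"])
      (simp_all add: complement_labeling_def)
  moreover have "(\<Sum>v\<in>F. ?g v) = 4 * (m * n + 1) - S" if F: "F \<in> proj_C4_faces m n" for F
  proof -
    have "?g v + f v = m * n + 1" if "v \<in> F" for v
      using that proj_C4_face_subset[OF F mn] bij_betwE[OF bij]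
      by (fastforce simp: complement_labeling_def)
    then have "(\<Sum>v\<in>F. ?g v) + S = 4 * (m * n + 1)"
      using card_proj_C4_face[OF F mn] by (simp flip: sum.distrib sum[OF F])
    then show ?thesis
      by simp
  qed
  ultimately show ?thesis
    by (simp add: C4_face_magic_labelings_def complement_labeling_def)
qed

lemma complement_labeling_complement:
  assumes "f \<in> C4_face_magic_labelings m n S"
  shows "complement_labeling m n (complement_labeling m n f) = f"
proof (rule extensionalityI[of _ "proj_vertices m n"])
  show "complement_labeling m n (complement_labeling m n f) v = f v"
    if "v \<in> proj_vertices m n" for v
    using that assms
    by (fastforce simp: complement_labeling_def C4_face_magic_labelings_def dest: bij_betwE)
qed (use assms in \<open>auto simp: complement_labeling_def C4_face_magic_labelings_def\<close>)

lemma card_C4_face_magic_labelings_complement: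
  assumes "m > 1" "n > 1"
  shows "card (C4_face_magic_labelings m n S)
    \<le> card (C4_face_magic_labelings m n (4 * (m * n + 1) - S))"
  using complement_labeling_in_C4_face_magic_labelings[OF assms] finite_C4_face_magic_labelings
  by (intro card_inj_on_le[of "complement_labeling m n"])
    (auto intro: inj_on_inverseI complement_labeling_complement)

lemma card_le_mult_card_quotient:
  assumes "refl_on A r" "r \<subseteq> A \<times> A" and class_le: "\<And>x. x \<in> A \<Longrightarrow> card (r `` {x}) \<le> k"
  shows "card A \<le> k * card (A // r)"
proof -
  have "A = \<Union> (A // r)"
    using assms(1,2) by (auto simp: quotient_def refl_on_def)
  then have "card A \<le> (\<Sum>C\<in>A // r. card C)"
    by (metis card_Union_le_sum_card)
  also have "\<dots> \<le> k * card (A // r)"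
    using sum_bounded_above[of "A // r" card k] class_le by (auto simp: quotient_def mult.commute)
  finally show ?thesis .
qed

lemma card_labeling_class_le: "card (labeling_equiv m n S `` {f}) \<le> 4"
proof -
  let ?h = "\<lambda>\<sigma>. restrict (f \<circ> \<sigma>) (proj_vertices m n)"
  have fin: "finite (proj_symmetries m n)" and le: "card (proj_symmetries m n) \<le> 4"
    by (simp_all add: proj_symmetries_def card_insert_if)
  have "g \<in> ?h ` proj_symmetries m n" if g: "(f, g) \<in> labeling_equiv m n S" for g
  proof -
    obtain \<sigma> where \<sigma>: "\<sigma> \<in> proj_symmetries m n" "\<forall>v\<in>proj_vertices m n. g v = f (\<sigma> v)"
      and "g \<in> extensional (proj_vertices m n)"
      using g by (auto simp: labeling_equiv_def C4_face_magic_labelings_def)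
    then have "g = ?h \<sigma>"
      by (intro extensionalityI[of _ "proj_vertices m n"]) auto
    with \<sigma>(1) show ?thesis by blast
  qed
  then have "labeling_equiv m n S `` {f} \<subseteq> ?h ` proj_symmetries m n"
    by blast
  with fin le show ?thesis
    by (meson card_image_le card_mono finite_imageI order_trans)
qed

lemma card_C4_face_magic_labelings_le:
  "card (C4_face_magic_labelings m n S) \<le> 4 * num_C4_face_magic_labelings m n S"
  unfolding num_C4_face_magic_labelings_def
proof (rule card_le_mult_card_quotient)
  show "refl_on (C4_face_magic_labelings m n S) (labeling_equiv m n S)"
    by (auto simp: refl_on_def labeling_equiv_def proj_symmetries_def)
  show "labeling_equiv m n S \<subseteq> C4_face_magic_labelings m n S \<times> C4_face_magic_labelings m n S"
    by (auto simp: labeling_equiv_def)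
qed (rule card_labeling_class_le)

theorem theorem42:
  fixes m n :: nat
  assumes "m \<ge> 3" and "n \<ge> 3" and "odd m" and "odd n" and "m \<noteq> n"
  shows "num_C4_face_magic_labelings m n (2 * m * n + 1)
           \<ge> (tau m n + tau n m) * 2 ^ ((m + n) div 2 - 3) * beta m * beta n \<and>
         num_C4_face_magic_labelings m n (2 * m * n + 3)
           \<ge> (tau m n + tau n m) * 2 ^ ((m + n) div 2 - 3) * beta m * beta n"
proof -
  let ?bound = "(tau m n + tau n m) * 2 ^ ((m + n) div 2 - 3) * beta m * beta n"
  have mn: "m > 1" "n > 1"
    using assms by auto
  have "m div 2 + n div 2 = 2 + ((m + n) div 2 - 3)"
    using assms by (auto elim!: oddE)
  then have "(2::nat) ^ (m div 2) * 2 ^ (n div 2) = 4 * 2 ^ ((m + n) div 2 - 3)"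
    by (simp flip: power_add)
  then have "4 * ?bound
      = (tau m n + tau n m) * ((2 ^ (m div 2) * beta m) * (2 ^ (n div 2) * beta n))"
    by (simp add: algebra_simps)
  also have "\<dots> \<le> card (C4_face_magic_labelings m n (2 * m * n + 3))"
    using assms(3,4) mn by (rule card_C4_face_magic_labelings_ge)
  finally have bound3: "4 * ?bound \<le> card (C4_face_magic_labelings m n (2 * m * n + 3))" .
  also have "\<dots> \<le> card (C4_face_magic_labelings m n (2 * m * n + 1))"
    using card_C4_face_magic_labelings_complement[OF mn, of "2 * m * n + 3"]
    by (simp add: mult.assoc)
  finally have bound1: "4 * ?bound \<le> card (C4_face_magic_labelings m n (2 * m * n + 1))" .
  from bound1 bound3 show ?thesis
    using card_C4_face_magic_labelings_le[of m n "2 * m * n + 1"]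
      card_C4_face_magic_labelings_le[of m n "2 * m * n + 3"]
    by linarith
qed

end
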